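(* Let $\rho>0$, and let $\mathcal{T}_D$ be a non-negative hierarchical tree of depth $T$ whose shape is fixed and whose attributes $q_D(u)$ are determined by a dataset $D$, with root attribute $q_D(u_0)=n$ equal to the (fixed) size of $D$. Let $\mathrm{GS}_2(q)$ be such that for every level $\ell\in\{1,\dots,T\}$ and every pair of bounded-neighboring datasets $D\sim D'$, $\|(q_D(u))_{u\in V_\ell}-(q_{D'}(u))_{u\in V_\ell}\|_2\le \mathrm{GS}_2(q)$. Then the mechanism $D\mapsto \texttt{InfTDA}(\mathcal{T}_D,\rho)$ satisfies $\mathrm{GS}_2(q)^2\frac{\rho}{2}$-zCDP under bounded privacy.
   Context: Datasets are tuples of $n$ user records; two datasets $D\sim D'$ are bounded neighbors if they have the same size and one is obtained from the other by substituting a single user's record. A randomized mechanism $\mathcal{M}$ is $\rho$-zCDP if for all neighbors $D\sim D'$ and all $\alpha>1$, $D_\alpha(\mathcal{M}(D)\|\mathcal{M}(D'))\le\alpha\rho$, with $D_\alpha$ the Rényi divergence of order $\alpha$. A non-negative hierarchical tree of depth $T$: rooted tree with levels $V_0=\{u_0\},V_1,\dots,V_T$, non-negative integer attributes, and for every non-leaf $u$ with children $\mathcal{C}(u)$, $q(u)=\sum_{v\in\mathcal{C}(u)}q(v)$; $\mathbf{q}_{\mathcal{C}}(u)$ is the vector of children attributes. $\mathcal{N}_{\mathbb{Z}}(0,\sigma^2)$ is the discrete Gaussian, $\Pr[Z=z]\propto e^{-z^2/(2\sigma^2)}$. $\texttt{IntOpt}_\infty(\mathbf{x},c)$ ($\mathbf{x}\in\mathbb{Z}^d$,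 $c$ integer): set $z_i\gets\max(\lceil(c-\sum_k x_k)/d\rceil,-x_i)$; $t\gets\|\mathbf{z}\|_\infty$; $I\gets$ indices sorted by ascending $x_i$; $j\gets0$; while $\sum_i z_i>c-\sum_i x_i$: $\Delta\gets\sum_i z_i-c+\sum_i x_i$, $z_{I[j]}\gets\max(z_{I[j]}-\Delta,-x_{I[j]},-t)$, $j\gets(j+1)\bmod|I|$, if $j=0$ then $t\gets t+1$; return $\mathbf{x}+\mathbf{z}$. \texttt{InfTDA}$(\mathcal{T},\rho)$: $\tilde V_0=\{(u_0,q(u_0))\}$; for $\ell=1,\dots,T$: $\tilde V_\ell=\emptyset$, and for each $(u,c)\in\tilde V_{\ell-1}$: $\tilde{\mathbf{q}}=\mathbf{q}_{\mathcal{C}}(u)+\mathbf{Z}$ with fresh i.i.d. $\mathcal{N}_{\mathbb{Z}}(0,T/\rho)$ coordinates, $\bar{\mathbf{q}}=\texttt{IntOpt}_\infty(\tilde{\mathbf{q}},c)$, and add to $\tilde V_\ell$ the pairs $(C_j,\bar q_j)$ with $\bar q_j>0$ ($C_j$ the $j$-th child of $u$). Output: the tree with node-value pairs $\bigcup_\ell \tilde V_\ell$. *)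

theory Defs
  imports "HOL-Probability.Probability" "HOL-Library.While_Combinator"
begin

section \<open>Zero-concentrated differential privacy under bounded neighbours\<close>

definition datasets :: "nat \<Rightarrow> 'r list set" where
  "datasets n = {D. length D = n}"

definition bounded_neighbors :: "'r list \<Rightarrow> 'r list \<Rightarrow> bool" where
  "bounded_neighbors D D' \<longleftrightarrow> (\<exists>i<length D. \<exists>r. D' = D[i := r])"

text \<open>
  For \<open>\<alpha> > 1\<close> this is \<open>ln (\<Sum>y. P(y)^\<alpha> * Q(y)^(1-\<alpha>)) / (\<alpha> - 1)\<close>. The value is \<open>\<infinity>\<close> if \<open>P\<close> is not
  absolutely continuous with respect to \<open>Q\<close>, or if the sum diverges.
  In the last branch the integral is finite and at least \<open>1\<close>, so \<open>enn2real\<close> and \<open>ln\<close> are harmless.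
\<close>
definition renyi_divergence :: "real \<Rightarrow> 'a pmf \<Rightarrow> 'a pmf \<Rightarrow> ereal" where
  "renyi_divergence \<alpha> P Q =
     (let I = (\<integral>\<^sup>+y. ennreal ((pmf P y / pmf Q y) powr \<alpha>) \<partial>measure_pmf Q)
      in if set_pmf P \<subseteq> set_pmf Q \<and> I < \<infinity> then ereal (ln (enn2real I) / (\<alpha> - 1)) else \<infinity>)"

definition zCDP ::
  "'d set \<Rightarrow> ('d \<Rightarrow> 'd \<Rightarrow> bool) \<Rightarrow> real \<Rightarrow> ('d \<Rightarrow> 'a pmf) \<Rightarrow> bool" where
  "zCDP X nbr \<rho> M \<longleftrightarrow>
     (\<forall>D\<in>X. \<forall>D'\<in>X. nbr D D' \<longrightarrow>
        (\<forall>\<alpha>>1. renyi_divergence \<alpha> (M D) (M D') \<le> ereal (\<alpha> * \<rho>)))"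

section \<open>The discrete Gaussian\<close>

text \<open>The parameter \<open>s\<close> is \<open>\<sigma>\<^sup>2\<close>, not \<open>\<sigma>\<close>. For \<open>s \<le> 0\<close> the value is unspecified.\<close>
definition discrete_gaussian :: "real \<Rightarrow> int pmf" where
  "discrete_gaussian s =
     embed_pmf (\<lambda>z. exp (- (of_int z)\<^sup>2 / (2 * s))
                     / (\<Sum>\<^sub>\<infinity>y. exp (- (of_int y)\<^sup>2 / (2 * s))))"

lemma summable_discrete_gaussian:
  assumes "s > 0"
  shows "(\<lambda>z::int. exp (- (of_int z)\<^sup>2 / (2 * s)) :: real) summable_on UNIV"
proof -
  define f where "f = (\<lambda>z::int. exp (- (of_int z)\<^sup>2 / (2 * s)) :: real)"
  define r where "r = exp (- 1 / (2 * s))"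
  have r: "0 < r" "r < 1" using assms by (auto simp: r_def)
  have le: "exp (- (of_nat n)\<^sup>2 / (2 * s)) \<le> r ^ n" for n :: nat
  proof -
    have "real n \<le> (real n)\<^sup>2" by (cases n) (auto simp: power2_eq_square)
    hence "- (of_nat n)\<^sup>2 / (2 * s) \<le> real n * (- 1 / (2 * s))"
      using assms by (simp add: divide_simps)
    thus ?thesis unfolding r_def exp_of_nat_mult[symmetric] by simp
  qed
  have *: "summable (\<lambda>n::nat. exp (- (of_nat n)\<^sup>2 / (2 * s)) :: real)"
    by (rule summable_comparison_test'[of "\<lambda>n. r ^ n" 0]) (use r le in \<open>auto simp: summable_geometric\<close>)
  hence **: "(\<lambda>n::nat. exp (- (of_nat n)\<^sup>2 / (2 * s)) :: real) summable_on UNIV"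
    by (subst summable_on_UNIV_nonneg_real_iff) auto
  have "f summable_on (range int)"
    by (subst summable_on_reindex) (use ** in \<open>auto simp: f_def o_def\<close>)
  moreover have "f summable_on (range (\<lambda>n. - int n))"
    by (subst summable_on_reindex) (use ** in \<open>auto simp: f_def o_def inj_on_def\<close>)
  ultimately have "f summable_on (range int \<union> range (\<lambda>n. - int n))"
    by (intro summable_on_union) 
  moreover have "range int \<union> range (\<lambda>n. - int n) = UNIV"
    by (metis (no_types, lifting) UNIV_eq_I Un_iff int_cases2 rangeI)
  ultimately show ?thesis by (simp add: f_def)
qed

lemma pmf_discrete_gaussian:
  assumes "s > 0"
  shows "pmf (discrete_gaussian s) z =
           exp (- (of_int z)\<^sup>2 / (2 * s)) / (\<Sum>\<^sub>\<infinity>y::int. exp (- (of_int y)\<^sup>2 / (2 * s)))"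
proof -
  define f where "f = (\<lambda>z::int. exp (- (of_int z)\<^sup>2 / (2 * s)) :: real)"
  define S where "S = infsum f UNIV"
  have sum: "f summable_on UNIV"
    using summable_discrete_gaussian[OF assms] by (simp add: f_def)
  have "f 0 \<le> S"
    unfolding S_def using sum finite_sum_le_infsum[of f UNIV "{0}"] by (simp add: f_def)
  hence S: "S > 0" by (simp add: f_def)
  have nn: "f z / S \<ge> 0" for z using S by (simp add: f_def)
  have "((\<lambda>z. f z / S) has_sum (S / S)) UNIV"
    using has_sum_divide_const[OF has_sum_infsum[OF sum], of S] by (simp add: S_def)
  hence hs: "((\<lambda>z. f z / S) has_sum 1) UNIV" using S by simp
  have "(\<integral>\<^sup>+z. ennreal (f z / S) \<partial>count_space UNIV) = 1"
  proof -
    have abs: "Infinite_Set_Sum.abs_summable_on (\<lambda>z. f z / S) UNIV"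
      unfolding abs_summable_equivalent[symmetric]
      using has_sum_imp_summable[OF hs] by (simp only: real_norm_def abs_of_nonneg[OF nn])
    have "(\<integral>\<^sup>+z. ennreal (f z / S) \<partial>count_space UNIV) = ennreal (infsetsum (\<lambda>z. f z / S) UNIV)"
      by (rule nn_integral_conv_infsetsum) (use abs nn in auto)
    also have "infsetsum (\<lambda>z. f z / S) UNIV = 1"
      using infsetsum_infsum[OF abs] infsumI[OF hs] by simp
    finally show ?thesis by simp
  qed
  thus ?thesis
    using nn unfolding discrete_gaussian_def f_def S_def by (subst pmf_embed_pmf) auto
qed

section \<open>Hierarchical trees\<close>

text \<open>
  A tree shape is given by its root \<open>u0\<close> and a function listing the children of each node; only the
  values of that function at nodes reachable from the root matter.
\<close>

primrec level :: "'v \<Rightarrow> ('v \<Rightarrow> 'v list) \<Rightarrow> nat \<Rightarrow> 'v set" where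
  "level u0 ch 0 = {u0}"
| "level u0 ch (Suc l) = (\<Union>u\<in>level u0 ch l. set (ch u))"

text \<open>
  Leaves may occur on every level. The root has no parent and no node has two parents, which
  makes the levels pairwise disjoint.
\<close>
definition rooted_tree :: "'v \<Rightarrow> ('v \<Rightarrow> 'v list) \<Rightarrow> nat \<Rightarrow> bool" where
  "rooted_tree u0 ch T \<longleftrightarrow>
     level u0 ch T \<noteq> {} \<and> level u0 ch (Suc T) = {} \<and>
     (let V = (\<Union>l\<le>T. level u0 ch l) in
        (\<forall>u\<in>V. distinct (ch u) \<and> u0 \<notin> set (ch u)) \<and>
        (\<forall>u\<in>V. \<forall>v\<in>V. u \<noteq> v \<longrightarrow> set (ch u) \<inter> set (ch v) = {}))"

definition nonneg_hierarchical_tree ::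
  "'v \<Rightarrow> ('v \<Rightarrow> 'v list) \<Rightarrow> nat \<Rightarrow> ('v \<Rightarrow> int) \<Rightarrow> bool" where
  "nonneg_hierarchical_tree u0 ch T q \<longleftrightarrow>
     rooted_tree u0 ch T \<and>
     (\<forall>u\<in>(\<Union>l\<le>T. level u0 ch l).
        q u \<ge> 0 \<and> (ch u \<noteq> [] \<longrightarrow> q u = (\<Sum>v\<in>set (ch u). q v)))"

section \<open>The algorithms\<close>

text \<open>
  Ties in the ordering of the indices are broken by position, as \<open>sort_key\<close> is stable.
  For \<open>c \<ge> 0\<close> (the only case in which the algorithm below calls \<open>int_opt\<close>) the loop terminates:
  if the excess \<open>\<Delta>\<close> is positive then some \<open>x\<^sub>i + z\<^sub>i\<close> is positive, and \<open>- t\<close> eventually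
  drops below every \<open>- x\<^sub>i\<close>. The \<open>0\<close> inserted in the maximum only matters for \<open>x = []\<close>.
\<close>
definition int_opt :: "int list \<Rightarrow> int \<Rightarrow> int list" where
  "int_opt x c =
     (let d = length x;
          I = sort_key (\<lambda>i. x ! i) [0..<d];
          z0 = map (\<lambda>a. max \<lceil>real_of_int (c - sum_list x) / real d\<rceil> (- a)) x;
          t0 = Max (insert 0 ((\<lambda>a. \<bar>a\<bar>) ` set z0));
          (z, t, j) =
            while (\<lambda>(z, t, j). sum_list z > c - sum_list x)
              (\<lambda>(z, t, j).
                 let \<Delta> = sum_list z - c + sum_list x;
                     i = I ! j;
                     z' = z[i := max (z ! i - \<Delta>) (max (- (x ! i)) (- t))];
                     j' = (j + 1) mod length I
                 in (z', if j' = 0 then t + 1 else t, j'))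
              (z0, t0, 0)
      in map2 (+) x z)"

definition inf_tda_node ::
  "('v \<Rightarrow> 'v list) \<Rightarrow> ('v \<Rightarrow> int) \<Rightarrow> real \<Rightarrow> 'v \<times> int \<Rightarrow> ('v \<times> int) set pmf" where
  "inf_tda_node ch q s = (\<lambda>(u, c).
     do {
       Z \<leftarrow> replicate_pmf (length (ch u)) (discrete_gaussian s);
       let y = int_opt (map2 (+) (map q (ch u)) Z) c;
       return_pmf {(ch u ! j, y ! j) | j. j < length (ch u) \<and> y ! j > 0}
     })"

text \<open>
  The pairs in the current level are processed with independent noise, whence the product
  distribution \<open>Pi_pmf\<close>.
\<close>
definition inf_tda_level ::
  "('v \<Rightarrow> 'v list) \<Rightarrow> ('v \<Rightarrow> int) \<Rightarrow> real \<Rightarrow> ('v \<times> int) set \<Rightarrow> ('v \<times> int) set pmf" where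
  "inf_tda_level ch q s V =
     map_pmf (\<lambda>f. \<Union>p\<in>V. f p) (Pi_pmf V {} (inf_tda_node ch q s))"

text \<open>The state after \<open>l\<close> iterations consists of the last level and the union of all levels so far.\<close>
primrec inf_tda_loop ::
  "'v \<Rightarrow> ('v \<Rightarrow> 'v list) \<Rightarrow> ('v \<Rightarrow> int) \<Rightarrow> real \<Rightarrow> nat \<Rightarrow>
     (('v \<times> int) set \<times> ('v \<times> int) set) pmf" where
  "inf_tda_loop u0 ch q s 0 = return_pmf ({(u0, q u0)}, {(u0, q u0)})"
| "inf_tda_loop u0 ch q s (Suc l) =
     do {
       (V, W) \<leftarrow> inf_tda_loop u0 ch q s l;
       V' \<leftarrow> inf_tda_level ch q s V;
       return_pmf (V', W \<union> V')
     }"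

definition inf_tda ::
  "'v \<Rightarrow> ('v \<Rightarrow> 'v list) \<Rightarrow> nat \<Rightarrow> ('v \<Rightarrow> int) \<Rightarrow> real \<Rightarrow> ('v \<times> int) set pmf" where
  "inf_tda u0 ch T q \<rho> = map_pmf snd (inf_tda_loop u0 ch q (real T / \<rho>) T)"

end

(*
  The moment E_Q[(P/Q)^\<alpha>] is multiplicative under adaptive composition and does not increase under
  post-processing, so Renyi budgets of successive steps add up. A level of the tree adds integer
  Gaussian noise of variance parameter s = T / \<rho> to children vectors of distinct nodes; these vectors
  are disjoint parts of one level of the tree, so whatever the nodes retained so far, the budgets of
  the nodes sum to at most \<alpha> GS2^2 / (2 s) = \<alpha> GS2^2 \<rho> / (2 T). The T levels together give
  \<alpha> GS2^2 \<rho> / 2. The integer optimisation is post-processing, since the total c it is given is part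
  of the previous output.

  For one Gaussian, completing the square reduces the claim to
  sum_z exp (-(z - c)^2 / (2 s)) \<le> sum_z exp (-z^2 / (2 s)) for real c.
*)
theory Submission
  imports Defs
begin

section \<open>Moment bounds for Renyi divergence\<close>

text \<open>Convexity of \<open>t powr a\<close>: its graph lies above the tangent at
  \<open>r\<close>. Young's inequality with conjugate exponents \<open>a\<close> and
  \<open>a / (a - 1)\<close> also covers \<open>r = 0\<close>. The form without subtraction carries
  over to \<open>ennreal\<close>.\<close>

lemma powr_above_tangent:
  fixes a r t :: real
  assumes "a > 1" "r \<ge> 0" "t \<ge> 0"
  shows "a * r powr (a - 1) * t \<le> t powr a + (a - 1) * r powr a"
proof -
  have "1 / a + 1 / (a / (a - 1)) = 1"
    using assms by (simp add: field_simps)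
  moreover have "a / (a - 1) > 1" using assms by (simp add: field_simps)
  ultimately have "t * r powr (a - 1)
      \<le> t powr a / a + (r powr (a - 1)) powr (a / (a - 1)) / (a / (a - 1))"
    using assms by (intro Youngs_inequality) auto
  moreover have "(r powr (a - 1)) powr (a / (a - 1)) = r powr a"
    using assms by (simp add: powr_powr)
  ultimately show ?thesis
    using assms by (simp add: field_simps)
qed

definition renyi_moment :: "real \<Rightarrow> 'a pmf \<Rightarrow> 'a pmf \<Rightarrow> ennreal" where
  "renyi_moment \<alpha> P Q = (\<integral>\<^sup>+y. ennreal ((pmf P y / pmf Q y) powr \<alpha>) \<partial>measure_pmf Q)"

text \<open>\<open>B\<close> bounds the divergence of order \<open>\<alpha>\<close>; in exponential
  form, products of moments become sums of budgets. The support condition is part of the bound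
  because the moment, taken under \<open>Q\<close>, does not see mass of \<open>P\<close> outside
  the support of \<open>Q\<close>.\<close>

definition renyi_bounded :: "real \<Rightarrow> 'a pmf \<Rightarrow> 'a pmf \<Rightarrow> real \<Rightarrow> bool" where
  "renyi_bounded \<alpha> P Q B \<longleftrightarrow>
     set_pmf P \<subseteq> set_pmf Q \<and> renyi_moment \<alpha> P Q \<le> ennreal (exp ((\<alpha> - 1) * B))"

lemma renyi_boundedD:
  assumes "renyi_bounded \<alpha> P Q B" "\<alpha> > 1"
  shows "renyi_divergence \<alpha> P Q \<le> ereal B"
proof -
  let ?I = "renyi_moment \<alpha> P Q"
  have sub: "set_pmf P \<subseteq> set_pmf Q" and le: "?I \<le> ennreal (exp ((\<alpha> - 1) * B))"
    using assms by (auto simp: renyi_bounded_def)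
  have fin: "?I < \<infinity>"
    using le by (metis ennreal_less_top infinity_ennreal_def order_le_less_trans)
  \<comment> \<open>Monotonicity of \<open>ln\<close> requires a positive moment. A zero moment
    would make the likelihood ratio vanish on the support of \<open>Q\<close>, which contains that
    of \<open>P\<close>.\<close>
  have "?I \<noteq> 0"
  proof
    assume "?I = 0"
    hence "AE y in measure_pmf Q. ennreal ((pmf P y / pmf Q y) powr \<alpha>) = 0"
      by (simp add: renyi_moment_def nn_integral_0_iff_AE)
    moreover obtain y where "y \<in> set_pmf P"
      using set_pmf_not_empty[of P] by blast
    ultimately show False
      using sub by (force simp: AE_measure_pmf_iff set_pmf_eq)
  qed
  hence "enn2real ?I > 0"
    using fin by (simp add: enn2real_positive_iff zero_less_iff_neq_zero)
  moreover have "enn2real ?I \<le> exp ((\<alpha> - 1) * B)"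
    using le by (intro enn2real_leI) auto
  ultimately have "ln (enn2real ?I) \<le> (\<alpha> - 1) * B"
    by (metis exp_gt_zero ln_exp ln_le_cancel_iff)
  hence "ln (enn2real ?I) / (\<alpha> - 1) \<le> B"
    using assms(2) by (simp add: field_simps)
  thus ?thesis
    using sub fin by (simp add: renyi_divergence_def renyi_moment_def[symmetric] Let_def)
qed

lemma renyi_bounded_refl:
  assumes "B \<ge> 0" "\<alpha> > 1"
  shows "renyi_bounded \<alpha> P P B"
proof -
  have "renyi_moment \<alpha> P P = (\<integral>\<^sup>+y. 1 \<partial>measure_pmf P)"
    unfolding renyi_moment_def
    by (intro nn_integral_cong_AE) (auto simp: AE_measure_pmf_iff set_pmf_eq)
  also have "\<dots> = ennreal 1" by simp
  also have "\<dots> \<le> ennreal (exp ((\<alpha> - 1) * B))"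
    using assms by (intro ennreal_leI) simp
  finally show ?thesis by (simp add: renyi_bounded_def)
qed

lemma renyi_bounded_mono:
  assumes "renyi_bounded \<alpha> P Q B" "B \<le> B'" "\<alpha> > 1"
  shows "renyi_bounded \<alpha> P Q B'"
proof -
  have "ennreal (exp ((\<alpha> - 1) * B)) \<le> ennreal (exp ((\<alpha> - 1) * B'))"
    using assms by (intro ennreal_leI) simp
  thus ?thesis
    using assms(1) unfolding renyi_bounded_def by (blast intro: order_trans)
qed

section \<open>Adaptive composition, post-processing and independent products\<close>

lemma renyi_moment_count_space:
  "renyi_moment \<alpha> P Q = (\<integral>\<^sup>+y. ennreal (pmf Q y * (pmf P y / pmf Q y) powr \<alpha>) \<partial>count_space UNIV)"
  by (simp add: renyi_moment_def nn_integral_measure_pmf ennreal_mult)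

lemma ennreal_pmf_bind_count_space:
  "ennreal (pmf (bind_pmf P K) y) = (\<integral>\<^sup>+x. ennreal (pmf P x * pmf (K x) y) \<partial>count_space UNIV)"
  by (simp add: ennreal_pmf_bind nn_integral_measure_pmf ennreal_mult)

text \<open>
  Averaging the tangent inequality at \<open>r = V / W\<close> over the weights of \<open>bind_pmf Q L\<close> is Jensen's
  inequality for \<open>\<lambda>t. t powr \<alpha>\<close>. The term \<open>(\<alpha> - 1) * r powr \<alpha> * W\<close> stays on the right until the end,
  because subtraction in \<open>ennreal\<close> is truncated.
\<close>
lemma renyi_moment_bind_pointwise:
  fixes P Q :: "'a pmf" and K L :: "'a \<Rightarrow> 'b pmf"
  assumes \<alpha>: "\<alpha> > 1"
    and PQ: "set_pmf P \<subseteq> set_pmf Q"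
    and KL: "\<And>x. x \<in> set_pmf P \<Longrightarrow> set_pmf (K x) \<subseteq> set_pmf (L x)"
  defines "V \<equiv> pmf (bind_pmf P K)" and "W \<equiv> pmf (bind_pmf Q L)"
  shows "ennreal (W y * (V y / W y) powr \<alpha>)
    \<le> (\<integral>\<^sup>+x. ennreal (pmf Q x * pmf (L x) y *
          (pmf P x / pmf Q x * (pmf (K x) y / pmf (L x) y)) powr \<alpha>) \<partial>count_space UNIV)"
    (is "_ \<le> ?R")
proof -
  define r where "r = V y / W y"
  define w where "w = (\<lambda>x. pmf Q x * pmf (L x) y)"
  define t where "t = (\<lambda>x. pmf P x / pmf Q x * (pmf (K x) y / pmf (L x) y))"
  have nn: "V y \<ge> 0" "W y \<ge> 0" "r \<ge> 0" "\<And>x. w x \<ge> 0" "\<And>x. t x \<ge> 0"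
    by (simp_all add: V_def W_def r_def w_def t_def)
  \<comment> \<open>The support inclusions ensure that no positive joint mass is lost to a division
    by zero.\<close>
  have wt: "w x * t x = pmf P x * pmf (K x) y" for x
  proof (cases "pmf P x = 0 \<or> pmf (K x) y = 0")
    case False
    hence "pmf Q x \<noteq> 0" "pmf (L x) y \<noteq> 0"
      using PQ KL[of x] by (auto simp: set_pmf_eq)
    thus ?thesis by (simp add: w_def t_def)
  qed (auto simp: w_def t_def)
  have V: "ennreal (V y) = (\<integral>\<^sup>+x. ennreal (w x * t x) \<partial>count_space UNIV)"
    by (simp add: V_def ennreal_pmf_bind_count_space wt)
  have W: "ennreal (W y) = (\<integral>\<^sup>+x. ennreal (w x) \<partial>count_space UNIV)"
    by (simp add: W_def ennreal_pmf_bind_count_space w_def)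
  have R: "?R = (\<integral>\<^sup>+x. ennreal (w x * t x powr \<alpha>) \<partial>count_space UNIV)"
    by (simp add: w_def t_def)
  show ?thesis
  proof (cases "W y = 0")
    case True
    thus ?thesis by simp
  next
    case False
    \<comment> \<open>The weights \<open>w\<close> have total \<open>W y\<close> and weighted mean
      \<open>r\<close> of \<open>t\<close>, so the tangent is taken at the mean. For
      \<open>r = 0\<close> also \<open>V y = 0\<close>, and both sides vanish.\<close>
    have "r powr (\<alpha> - 1) * V y = r powr \<alpha> * W y"
    proof (cases "r = 0")
      case False
      hence "r powr \<alpha> = r powr (\<alpha> - 1) * r"
        using nn(3) by (simp add: powr_diff)
      thus ?thesis using \<open>W y \<noteq> 0\<close> by (simp add: r_def)
    qed (use False in \<open>auto simp: r_def\<close>)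
    hence "W y * r powr \<alpha> + (\<alpha> - 1) * r powr \<alpha> * W y = \<alpha> * r powr (\<alpha> - 1) * V y"
      by (simp add: algebra_simps)
    hence "ennreal (W y * r powr \<alpha>) + ennreal ((\<alpha> - 1) * r powr \<alpha> * W y)
        = ennreal (\<alpha> * r powr (\<alpha> - 1)) * ennreal (V y)"
      using \<alpha> nn by (simp add: ennreal_plus[symmetric] ennreal_mult[symmetric] del: ennreal_plus)
    also have "\<dots> = (\<integral>\<^sup>+x. ennreal (w x * (\<alpha> * r powr (\<alpha> - 1) * t x)) \<partial>count_space UNIV)"
      using \<alpha> nn by (simp add: V nn_integral_cmult[symmetric] ennreal_mult[symmetric] ac_simps)
    also have "\<dots> \<le> (\<integral>\<^sup>+x. ennreal (w x * (t x powr \<alpha> + (\<alpha> - 1) * r powr \<alpha>)) \<partial>count_space UNIV)"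
      using powr_above_tangent[OF \<alpha> nn(3) nn(5)] nn(4)
      by (intro nn_integral_mono ennreal_leI mult_left_mono) auto
    also have "\<dots> = (\<integral>\<^sup>+x. ennreal (w x * t x powr \<alpha>) +
                        ennreal ((\<alpha> - 1) * r powr \<alpha>) * ennreal (w x) \<partial>count_space UNIV)"
      using \<alpha> nn by (intro nn_integral_cong)
        (simp add: ennreal_plus[symmetric] ennreal_mult[symmetric] distrib_left ac_simps
          del: ennreal_plus)
    also have "\<dots> = ?R + ennreal ((\<alpha> - 1) * r powr \<alpha> * W y)"
      unfolding R using \<alpha> nn
      by (simp add: nn_integral_add nn_integral_cmult W[symmetric]
          ennreal_mult'[of "(\<alpha> - 1) * r powr \<alpha>" "W y"])
    \<comment> \<open>The common summand comes from a real number, so it is finite and can be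
      cancelled.\<close>
    finally show ?thesis
      by (simp add: r_def add.commute ennreal_add_left_cancel_le)
  qed
qed

text \<open>After the pointwise Jensen bound, Tonelli lets \<open>y\<close> be summed first for
  fixed \<open>x\<close>, which leaves the moment of \<open>K x\<close> against \<open>L x\<close>.
  Outside the support of \<open>P\<close> its factor is zero, so bounds on the kernels are required
  only on that support.\<close>

lemma renyi_bounded_bind:
  fixes P Q :: "'a pmf" and K L :: "'a \<Rightarrow> 'b pmf"
  assumes \<alpha>: "\<alpha> > 1"
    and PQ: "renyi_bounded \<alpha> P Q A"
    and KL: "\<And>x. x \<in> set_pmf P \<Longrightarrow> renyi_bounded \<alpha> (K x) (L x) B"
  shows "renyi_bounded \<alpha> (bind_pmf P K) (bind_pmf Q L) (A + B)"
proof -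
  have sub: "set_pmf P \<subseteq> set_pmf Q" "\<And>x. x \<in> set_pmf P \<Longrightarrow> set_pmf (K x) \<subseteq> set_pmf (L x)"
    using PQ KL by (auto simp: renyi_bounded_def)
  let ?r = "\<lambda>x. (pmf P x / pmf Q x) powr \<alpha>"
  have "renyi_moment \<alpha> (bind_pmf P K) (bind_pmf Q L)
    \<le> (\<integral>\<^sup>+y. \<integral>\<^sup>+x. ennreal (pmf Q x * pmf (L x) y *
          (pmf P x / pmf Q x * (pmf (K x) y / pmf (L x) y)) powr \<alpha>)
        \<partial>count_space UNIV \<partial>count_space UNIV)"
    unfolding renyi_moment_count_space
    by (intro nn_integral_mono renyi_moment_bind_pointwise \<alpha> sub)
  also have "\<dots> = (\<integral>\<^sup>+x. \<integral>\<^sup>+y. ennreal (pmf Q x * pmf (L x) y *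
          (pmf P x / pmf Q x * (pmf (K x) y / pmf (L x) y)) powr \<alpha>)
        \<partial>count_space UNIV \<partial>count_space UNIV)"
    using nn_integral_fst_count_space[of "\<lambda>(x, y). ennreal (pmf Q x * pmf (L x) y *
          (pmf P x / pmf Q x * (pmf (K x) y / pmf (L x) y)) powr \<alpha>)"]
      nn_integral_snd_count_space[of "\<lambda>(x, y). ennreal (pmf Q x * pmf (L x) y *
          (pmf P x / pmf Q x * (pmf (K x) y / pmf (L x) y)) powr \<alpha>)"]
    by simp
  also have "\<dots> = (\<integral>\<^sup>+x. \<integral>\<^sup>+y. ennreal (pmf Q x * ?r x) *
          ennreal (pmf (L x) y * (pmf (K x) y / pmf (L x) y) powr \<alpha>)
        \<partial>count_space UNIV \<partial>count_space UNIV)"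
    by (intro nn_integral_cong) (simp add: ennreal_mult[symmetric] powr_mult powr_divide)
  also have "\<dots> = (\<integral>\<^sup>+x. ennreal (pmf Q x * ?r x) * renyi_moment \<alpha> (K x) (L x) \<partial>count_space UNIV)"
    by (simp add: nn_integral_cmult renyi_moment_count_space)
  also have "\<dots> \<le> (\<integral>\<^sup>+x. ennreal (exp ((\<alpha> - 1) * B)) * ennreal (pmf Q x * ?r x) \<partial>count_space UNIV)"
  proof (intro nn_integral_mono)
    fix x
    show "ennreal (pmf Q x * ?r x) * renyi_moment \<alpha> (K x) (L x)
        \<le> ennreal (exp ((\<alpha> - 1) * B)) * ennreal (pmf Q x * ?r x)"
    proof (cases "x \<in> set_pmf P")
      case True
      thus ?thesis
        using KL[OF True] by (subst mult.commute) (auto simp: renyi_bounded_def intro!: mult_right_mono)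
    qed (simp add: set_pmf_eq)
  qed
  also have "\<dots> = ennreal (exp ((\<alpha> - 1) * B)) * renyi_moment \<alpha> P Q"
    by (simp add: nn_integral_cmult renyi_moment_count_space)
  also have "\<dots> \<le> ennreal (exp ((\<alpha> - 1) * B)) * ennreal (exp ((\<alpha> - 1) * A))"
    using PQ by (intro mult_left_mono) (auto simp: renyi_bounded_def)
  also have "\<dots> = ennreal (exp ((\<alpha> - 1) * (A + B)))"
    by (simp add: ennreal_mult[symmetric] exp_add[symmetric] algebra_simps)
  finally show ?thesis
    using sub by (auto simp: renyi_bounded_def)
qed

text \<open>Post-processing is composition with the same deterministic kernel on both sides, at cost
  zero.\<close>

lemma renyi_bounded_map:
  assumes "\<alpha> > 1" "renyi_bounded \<alpha> P Q B"
  shows "renyi_bounded \<alpha> (map_pmf f P) (map_pmf f Q) B"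
  using renyi_bounded_bind[OF assms renyi_bounded_refl[OF order.refl assms(1)]]
  by (simp add: map_pmf_def)

text \<open>Draw the coordinate at \<open>x\<close> first; the kernel that follows is a
  deterministic image of the product over \<open>A\<close>, so independence is a special case of
  adaptive composition.\<close>

lemma renyi_bounded_Pi_pmf:
  assumes "\<alpha> > 1" "finite A" "\<And>x. x \<in> A \<Longrightarrow> renyi_bounded \<alpha> (p x) (p' x) (B x)"
  shows "renyi_bounded \<alpha> (Pi_pmf A d p) (Pi_pmf A d p') (\<Sum>x\<in>A. B x)"
  using assms(2,3)
proof (induction A rule: finite_induct)
  case empty
  thus ?case using assms(1) by (simp add: renyi_bounded_refl)
next
  case (insert x A)
  have "renyi_bounded \<alpha> (Pi_pmf A d p \<bind> (\<lambda>f. return_pmf (f(x := y))))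
          (Pi_pmf A d p' \<bind> (\<lambda>f. return_pmf (f(x := y)))) (\<Sum>x\<in>A. B x)" for y
    using insert renyi_bounded_map[OF assms(1), of _ _ _ "\<lambda>f. f(x := y)"]
    by (simp add: map_pmf_def)
  thus ?case
    using insert assms(1) by (simp add: Pi_pmf_insert' renyi_bounded_bind)
qed

section \<open>Translates of the discrete Gaussian\<close>

text \<open>A theta function of the real centre \<open>c\<close>, with \<open>s\<close> the variance
  parameter. Values in \<open>ennreal\<close> allow sums to be exchanged before finiteness is
  known.\<close>

definition gaussian_sum :: "real \<Rightarrow> real \<Rightarrow> ennreal" where
  "gaussian_sum s c = (\<integral>\<^sup>+z. ennreal (exp (- (of_int z - c)\<^sup>2 / (2 * s))) \<partial>count_space (UNIV :: int set))"

lemma gaussian_sum_normalization: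
  assumes "s > 0"
  obtains S where "S > 0" "gaussian_sum s 0 = ennreal S"
    "\<And>z. pmf (discrete_gaussian s) z = exp (- (of_int z)\<^sup>2 / (2 * s)) / S"
proof -
  define S :: real where "S = (\<Sum>\<^sub>\<infinity>y::int. exp (- (of_int y)\<^sup>2 / (2 * s)))"
  have pmf: "pmf (discrete_gaussian s) z = exp (- (of_int z)\<^sup>2 / (2 * s)) / S" for z
    using pmf_discrete_gaussian[OF assms] by (simp add: S_def)
  \<comment> \<open>If \<open>S\<close> were zero, division by zero would make every mass zero,
    although the support is non-empty.\<close>
  have "pmf (discrete_gaussian s) z \<noteq> 0" if "z \<in> set_pmf (discrete_gaussian s)" for z
    using that by (simp add: set_pmf_eq)
  with set_pmf_not_empty[of "discrete_gaussian s"] have "S \<noteq> 0"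
    using pmf by fastforce
  moreover have "S \<ge> 0"
    unfolding S_def by (intro infsum_nonneg) simp
  ultimately have S: "S > 0" by simp
  have "1 = (\<integral>\<^sup>+z. ennreal (pmf (discrete_gaussian s) z) \<partial>count_space UNIV)"
    by (simp add: nn_integral_pmf)
  also have "\<dots> = (\<integral>\<^sup>+z. ennreal (1 / S) * ennreal (exp (- (of_int z - 0)\<^sup>2 / (2 * s))) \<partial>count_space UNIV)"
    using S by (intro nn_integral_cong) (simp add: pmf ennreal_mult[symmetric])
  also have "\<dots> = ennreal (1 / S) * gaussian_sum s 0"
    by (simp add: nn_integral_cmult gaussian_sum_def)
  finally have "ennreal S * 1 = ennreal S * ennreal (1 / S) * gaussian_sum s 0"
    by (simp add: mult.assoc)
  also have "ennreal S * ennreal (1 / S) = 1"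
    using S by (simp add: ennreal_mult[symmetric])
  finally have "gaussian_sum s 0 = ennreal S" by simp
  thus ?thesis
    using that[OF S] pmf by blast
qed

text \<open>Period one in the centre reduces uniform bounds to centres in the unit interval.\<close>

lemma gaussian_sum_shift: "gaussian_sum s (c + of_int k) = gaussian_sum s c"
proof -
  have "bij (\<lambda>z::int. z + k)"
    by (rule bij_betw_byWitness[of _ "\<lambda>z. z - k"]) auto
  from nn_integral_bij_count_space[OF this, of "\<lambda>z. ennreal (exp (- (of_int z - (c + of_int k))\<^sup>2 / (2 * s)))"]
  show ?thesis by (simp add: gaussian_sum_def)
qed

lemma gaussian_sum_le:
  assumes "s > 0"
  shows "gaussian_sum s c \<le> ennreal (exp (1 / (2 * s))) * gaussian_sum (2 * s) 0"
proof -
  define e where "e = frac c"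
  have e: "0 \<le> e" "e < 1" by (auto simp: e_def frac_lt_1)
  have "gaussian_sum s c = gaussian_sum s e"
    using gaussian_sum_shift[of s e "\<lfloor>c\<rfloor>"] by (simp add: e_def frac_def)
  also have "\<dots> \<le> (\<integral>\<^sup>+z. ennreal (exp (1 / (2 * s))) *
      ennreal (exp (- (of_int z - 0)\<^sup>2 / (2 * (2 * s)))) \<partial>count_space (UNIV :: int set))"
    unfolding gaussian_sum_def
  proof (intro nn_integral_mono)
    fix z :: int
    define x :: real where "x = of_int z"
    \<comment> \<open>This trades the shift by \<open>e\<close> for a doubled variance parameter and
      a constant factor, uniformly in \<open>c\<close>.\<close>
    have "x\<^sup>2 \<le> 2 * (x - e)\<^sup>2 + 2 * e\<^sup>2"
      using zero_le_power2[of "x - 2 * e"] by (simp add: power2_eq_square algebra_simps)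
    moreover have "e\<^sup>2 \<le> 1" using e by (simp add: power_le_one)
    ultimately have "- (x - e)\<^sup>2 \<le> 1 - x\<^sup>2 / 2" by simp
    hence "- (x - e)\<^sup>2 / (2 * s) \<le> (1 - x\<^sup>2 / 2) / (2 * s)"
      using assms by (intro divide_right_mono) auto
    also have "\<dots> = 1 / (2 * s) + - (x - 0)\<^sup>2 / (2 * (2 * s))"
      using assms by (simp add: field_simps)
    finally have "exp (- (x - e)\<^sup>2 / (2 * s)) \<le> exp (1 / (2 * s)) * exp (- (x - 0)\<^sup>2 / (2 * (2 * s)))"
      by (simp add: exp_add[symmetric])
    thus "ennreal (exp (- (of_int z - e)\<^sup>2 / (2 * s))) \<le> ennreal (exp (1 / (2 * s))) *
      ennreal (exp (- (of_int z - 0)\<^sup>2 / (2 * (2 * s))))"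
      by (simp add: ennreal_mult[symmetric] x_def ennreal_leI)
  qed
  also have "\<dots> = ennreal (exp (1 / (2 * s))) * gaussian_sum (2 * s) 0"
    by (simp add: nn_integral_cmult gaussian_sum_def)
  finally show ?thesis .
qed

text \<open>
  The rotation \<open>(x, y) \<mapsto> (x + y, x - y)\<close> maps \<open>\<int>\<^sup>2\<close> onto the pairs of equal parity; \<open>p\<close> is that
  parity.
\<close>
lemma gaussian_sum_mult:
  assumes "s > 0"
  shows "gaussian_sum s c * gaussian_sum s d =
    (\<Sum>p\<in>UNIV. gaussian_sum (s / 2) ((c + d - of_bool p) / 2) * gaussian_sum (s / 2) ((c - d - of_bool p) / 2))"
proof -
  define h :: "int \<times> int \<Rightarrow> ennreal" where
    "h = (\<lambda>(x, y). ennreal (exp (- (of_int x - c)\<^sup>2 / (2 * s))) * ennreal (exp (- (of_int y - d)\<^sup>2 / (2 * s))))"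
  define g :: "bool \<times> int \<times> int \<Rightarrow> int \<times> int" where
    "g = (\<lambda>(p, i, j). (i + j + of_bool p, i - j))"
  have "bij g"
  proof (rule bij_betw_byWitness[of _ "\<lambda>(x, y). (odd (x + y), (x + y) div 2, (x - y) div 2)"])
    show "\<forall>a\<in>UNIV. (case g a of (x, y) \<Rightarrow> (odd (x + y), (x + y) div 2, (x - y) div 2)) = a"
    proof (intro ballI)
      fix a :: "bool \<times> int \<times> int"
      obtain p i j where a: "a = (p, i, j)" by (cases a)
      show "(case g a of (x, y) \<Rightarrow> (odd (x + y), (x + y) div 2, (x - y) div 2)) = a"
        by (cases p) (auto simp: a g_def)
    qed
    show "\<forall>a\<in>UNIV. g (case a of (x, y) \<Rightarrow> (odd (x + y), (x + y) div 2, (x - y) div 2)) = a"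
    proof (intro ballI)
      fix a :: "int \<times> int"
      obtain x y where a: "a = (x, y)" by (cases a)
      have "even (x + y) \<longleftrightarrow> even (x - y)" by simp
      thus "g (case a of (x, y) \<Rightarrow> (odd (x + y), (x + y) div 2, (x - y) div 2)) = a"
        by (auto simp: a g_def) presburger+
    qed
  qed auto
  have split: "h (g (p, i, j)) = ennreal (exp (- (of_int i - (c + d - of_bool p) / 2)\<^sup>2 / (2 * (s / 2)))) *
      ennreal (exp (- (of_int j - (c - d - of_bool p) / 2)\<^sup>2 / (2 * (s / 2))))" for p i j
  proof -
    \<comment> \<open>The parallelogram law in the coordinates
      \<open>x + y = 2 * i + of_bool p\<close> and \<open>x - y = 2 * j + of_bool p\<close>; the
      factor 2 pulled out of each halves \<open>s\<close>.\<close>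
    have "- (of_int (i + j + of_bool p) - c)\<^sup>2 / (2 * s) + - (of_int (i - j) - d)\<^sup>2 / (2 * s)
        = - (of_int i - (c + d - of_bool p) / 2)\<^sup>2 / (2 * (s / 2)) +
          - (of_int j - (c - d - of_bool p) / 2)\<^sup>2 / (2 * (s / 2))"
      using assms by (simp add: field_simps power2_eq_square)
    thus ?thesis
      by (simp add: h_def g_def ennreal_mult[symmetric] exp_add[symmetric])
  qed
  have "gaussian_sum s c * gaussian_sum s d = (\<integral>\<^sup>+x. \<integral>\<^sup>+y. h (x, y) \<partial>count_space UNIV \<partial>count_space UNIV)"
    by (simp add: h_def gaussian_sum_def nn_integral_cmult nn_integral_multc)
  also have "\<dots> = (\<integral>\<^sup>+a. h a \<partial>count_space UNIV)"
    by (rule nn_integral_fst_count_space)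
  also have "\<dots> = (\<integral>\<^sup>+a. h (g a) \<partial>count_space UNIV)"
    by (rule nn_integral_bij_count_space[OF \<open>bij g\<close>, symmetric])
  also have "\<dots> = (\<integral>\<^sup>+p. \<integral>\<^sup>+i. \<integral>\<^sup>+j. h (g (p, i, j)) \<partial>count_space UNIV \<partial>count_space UNIV \<partial>count_space UNIV)"
    by (simp add: nn_integral_fst_count_space[of "\<lambda>a. h (g (_, a))"]
        nn_integral_fst_count_space[of "\<lambda>a. h (g a)"])
  also have "\<dots> = (\<integral>\<^sup>+p. gaussian_sum (s / 2) ((c + d - of_bool p) / 2) * gaussian_sum (s / 2) ((c - d - of_bool p) / 2) \<partial>count_space UNIV)"
    by (simp add: split gaussian_sum_def nn_integral_cmult nn_integral_multc)
  also have "\<dots> = (\<Sum>p\<in>UNIV. gaussian_sum (s / 2) ((c + d - of_bool p) / 2) * gaussian_sum (s / 2) ((c - d - of_bool p) / 2))"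
    by (rule nn_integral_count_space_finite) simp
  finally show ?thesis .
qed

lemma gaussian_sum_finite:
  assumes "s > 0"
  shows "gaussian_sum s c < \<infinity>"
proof -
  obtain S where "gaussian_sum (2 * s) 0 = ennreal S"
    using gaussian_sum_normalization[of "2 * s"] assms by auto
  with gaussian_sum_le[OF assms, of c]
  have "gaussian_sum s c \<le> ennreal (exp (1 / (2 * s)) * S)"
    by (simp add: ennreal_mult')
  thus ?thesis
    using le_less_trans by fastforce
qed

text \<open>
  This avoids Poisson summation. With \<open>r c = gaussian_sum s c / gaussian_sum s 0\<close>, the product
  formula and \<open>2 * a * b \<le> a\<^sup>2 + b\<^sup>2\<close> give \<open>r (2 * c) - 1 \<ge> 2 * ((r c)\<^sup>2 - 1)\<close>; so if \<open>r c > 1\<close> then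
  \<open>r (2 ^ k * c)\<close> tends to infinity, contradicting boundedness.
\<close>
lemma gaussian_sum_le_centered:
  assumes s: "s > 0"
  shows "gaussian_sum s c \<le> gaussian_sum s 0"
proof -
  define f where "f = (\<lambda>c. enn2real (gaussian_sum s c))"
  have f: "gaussian_sum s c = ennreal (f c)" for c
    using gaussian_sum_finite[OF s] by (simp add: f_def)
  have f_nonneg: "f c \<ge> 0" for c by (simp add: f_def)
  obtain S where "S > 0" "gaussian_sum s 0 = ennreal S"
    using gaussian_sum_normalization[OF s] by metis
  hence f0: "f 0 > 0" by (simp add: f_def)
  define g where "g = (\<lambda>p c. enn2real (gaussian_sum (s / 2) ((c - of_bool p) / 2)))"
  have g: "gaussian_sum (s / 2) ((c - of_bool p) / 2) = ennreal (g p c)" for c p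
    using gaussian_sum_finite[of "s / 2"] s by (simp add: g_def)
  have g_nonneg: "g p c \<ge> 0" for p c by (simp add: g_def)
  have fg: "f c * f d = (\<Sum>p\<in>UNIV. g p (c + d) * g p (c - d))" for c d
  proof -
    have "ennreal (f c * f d) = (\<Sum>p\<in>UNIV. ennreal (g p (c + d)) * ennreal (g p (c - d)))"
      using gaussian_sum_mult[OF s, of c d] by (simp add: f g f_nonneg ennreal_mult)
    also have "\<dots> = ennreal (\<Sum>p\<in>UNIV. g p (c + d) * g p (c - d))"
      by (subst sum_ennreal[symmetric]) (simp_all add: g_nonneg ennreal_mult)
    finally show ?thesis
      by (simp add: f_nonneg g_nonneg sum_nonneg)
  qed
  \<comment> \<open>The product formula at \<open>(c, c)\<close> gives mixed products of
    \<open>g p (2 * c)\<close> and \<open>g p 0\<close>; the squares that bound them are the product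
    formula at \<open>(2 * c, 0)\<close> and \<open>(0, 0)\<close>.\<close>
  have double: "2 * (f c)\<^sup>2 \<le> f (2 * c) * f 0 + (f 0)\<^sup>2" for c
  proof -
    have "2 * (f c)\<^sup>2 = (\<Sum>p\<in>UNIV. 2 * g p (2 * c) * g p 0)"
      using fg[of c c] by (simp add: power2_eq_square sum_distrib_left mult.assoc)
    also have "\<dots> \<le> (\<Sum>p\<in>UNIV. g p (2 * c) * g p (2 * c) + g p 0 * g p 0)"
      by (intro sum_mono) (use sum_squares_bound in \<open>simp add: power2_eq_square\<close>)
    also have "\<dots> = f (2 * c) * f 0 + (f 0)\<^sup>2"
      using fg[of "2 * c" 0] fg[of 0 0] by (simp add: power2_eq_square sum.distrib)
    finally show ?thesis .
  qed
  \<comment> \<open>The relative excess over the centred sum. Expanding the doubling inequality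
    around 1 and dropping the square of \<open>d c\<close> yields growth by the factor 4.\<close>
  define d where "d = (\<lambda>c. f c / f 0 - 1)"
  have d_double: "4 * d c \<le> d (2 * c)" for c
  proof -
    have "2 * (f c / f 0)\<^sup>2 \<le> f (2 * c) / f 0 + 1"
      using double[of c] f0 by (simp add: field_simps power2_eq_square)
    hence "2 * (d c + 1)\<^sup>2 \<le> d (2 * c) + 2"
      by (simp add: d_def)
    moreover have "2 * (d c + 1)\<^sup>2 = 2 * (d c)\<^sup>2 + 4 * d c + 2"
      by (simp add: power2_eq_square algebra_simps)
    ultimately show ?thesis
      using zero_le_power2[of "d c"] by linarith
  qed
  have d_pow: "4 ^ k * d c \<le> d (2 ^ k * c)" for k c
  proof (induction k)
    case (Suc k)
    thus ?case using d_double[of "2 ^ k * c"] by (simp add: mult.assoc)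
  qed simp
  obtain B where B: "\<And>c. f c \<le> B"
  proof -
    define b where "b = enn2real (ennreal (exp (1 / (2 * s))) * gaussian_sum (2 * s) 0)"
    have "f c \<le> b" for c
      unfolding f_def b_def using gaussian_sum_le[OF s] gaussian_sum_finite[of "2 * s"] s
      by (intro enn2real_mono) (auto simp: ennreal_mult_less_top)
    thus ?thesis using that by blast
  qed
  have "d c \<le> 0"
  proof (rule ccontr)
    assume "\<not> d c \<le> 0"
    then obtain k where "B / f 0 / d c < 4 ^ k"
      using real_arch_pow[of 4 "B / f 0 / d c"] by auto
    hence "B / f 0 < 4 ^ k * d c"
      using \<open>\<not> d c \<le> 0\<close> by (subst (asm) pos_divide_less_eq) simp_all
    also have "\<dots> \<le> d (2 ^ k * c)" by (rule d_pow)
    also have "\<dots> \<le> B / f 0"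
      using B[of "2 ^ k * c"] f0 divide_right_mono[of "f (2 ^ k * c)" B "f 0"] by (simp add: d_def)
    finally show False by simp
  qed
  hence "f c \<le> f 0"
    using f0 by (simp add: d_def)
  thus ?thesis by (simp add: f ennreal_leI)
qed

section \<open>Budget of integer Gaussian noise\<close>

lemma renyi_bounded_discrete_gaussian:
  fixes a b :: int
  assumes s: "s > 0" and \<alpha>: "\<alpha> > 1"
  shows "renyi_bounded \<alpha> (map_pmf ((+) a) (discrete_gaussian s)) (map_pmf ((+) b) (discrete_gaussian s))
           (\<alpha> * (of_int (a - b))\<^sup>2 / (2 * s))"
proof -
  obtain S where S: "S > 0" "gaussian_sum s 0 = ennreal S"
    "\<And>z. pmf (discrete_gaussian s) z = exp (- (of_int z)\<^sup>2 / (2 * s)) / S"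
    using gaussian_sum_normalization[OF s] by metis
  have pmf: "pmf (map_pmf ((+) a) (discrete_gaussian s)) z = exp (- (of_int z - of_int a)\<^sup>2 / (2 * s)) / S"
    for a z :: int
    using pmf_map_inj'[of "(+) a" "discrete_gaussian s" "z - a"] by (simp add: S)
  \<comment> \<open>\<open>\<mu>\<close> is the centre and \<open>C\<close> the constant factor
    produced by completing the square. \<open>\<mu>\<close> is in general not an integer, so
    periodicity alone does not compare its sum with the centred one.\<close>
  define \<mu> :: real where "\<mu> = \<alpha> * of_int a + (1 - \<alpha>) * of_int b"
  define C where "C = exp ((\<alpha> - 1) * (\<alpha> * (of_int (a - b))\<^sup>2 / (2 * s)))"
  have eq: "pmf (map_pmf ((+) b) (discrete_gaussian s)) z * (pmf (map_pmf ((+) a) (discrete_gaussian s)) z /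
         pmf (map_pmf ((+) b) (discrete_gaussian s)) z) powr \<alpha>
      = C / S * exp (- (of_int z - \<mu>)\<^sup>2 / (2 * s))" for z
  proof -
    define x :: real where "x = of_int z"
    have "- (x - of_int b)\<^sup>2 / (2 * s) + \<alpha> * (- (x - of_int a)\<^sup>2 / (2 * s) - - (x - of_int b)\<^sup>2 / (2 * s))
        = (\<alpha> - 1) * (\<alpha> * (of_int (a - b))\<^sup>2 / (2 * s)) + - (x - \<mu>)\<^sup>2 / (2 * s)"
      using s by (simp add: \<mu>_def field_simps power2_eq_square)
    thus ?thesis
      using S(1) by (simp only: pmf x_def[symmetric] C_def)
        (simp add: exp_diff[symmetric] exp_add[symmetric] powr_def)
  qed
  have "renyi_moment \<alpha> (map_pmf ((+) a) (discrete_gaussian s)) (map_pmf ((+) b) (discrete_gaussian s))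
      = (\<integral>\<^sup>+z. ennreal (C / S) * ennreal (exp (- (of_int z - \<mu>)\<^sup>2 / (2 * s))) \<partial>count_space UNIV)"
    using S(1) by (simp add: renyi_moment_count_space eq ennreal_mult[symmetric] C_def)
  also have "\<dots> = ennreal (C / S) * gaussian_sum s \<mu>"
    by (simp add: nn_integral_cmult gaussian_sum_def)
  also have "\<dots> \<le> ennreal (C / S) * ennreal S"
    using gaussian_sum_le_centered[OF s, of \<mu>] by (intro mult_left_mono) (auto simp: S)
  also have "\<dots> = ennreal C"
    using S(1) by (simp add: ennreal_mult[symmetric] C_def)
  finally have "renyi_moment \<alpha> (map_pmf ((+) a) (discrete_gaussian s)) (map_pmf ((+) b) (discrete_gaussian s))
      \<le> ennreal C" .
  \<comment> \<open>Every integer has positive mass under each translate, which settles the support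
    condition.\<close>
  moreover have "set_pmf (map_pmf ((+) a) (discrete_gaussian s)) = UNIV" for a
    using S(1) by (auto simp: set_pmf_iff pmf simp del: set_map_pmf)
  ultimately show ?thesis
    by (simp add: renyi_bounded_def C_def del: set_map_pmf)
qed

text \<open>The noisy head is drawn first and the independent noisy tail follows as a kernel, so the
  squared differences add up coordinate by coordinate.\<close>

lemma renyi_bounded_gaussian_noise:
  fixes f f' :: "'v \<Rightarrow> int"
  assumes s: "s > 0" and \<alpha>: "\<alpha> > 1"
  shows "renyi_bounded \<alpha>
    (map_pmf (map2 (+) (map f us)) (replicate_pmf (length us) (discrete_gaussian s)))
    (map_pmf (map2 (+) (map f' us)) (replicate_pmf (length us) (discrete_gaussian s)))
    (\<Sum>u\<leftarrow>us. \<alpha> * (of_int (f u - f' u))\<^sup>2 / (2 * s))"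
proof (induction us)
  case Nil
  thus ?case using \<alpha> by (simp add: renyi_bounded_refl)
next
  case (Cons u us)
  let ?N = "discrete_gaussian s"
  have unfold: "map_pmf (map2 (+) (map f (u # us))) (replicate_pmf (length (u # us)) ?N)
      = map_pmf ((+) (f u)) ?N \<bind>
          (\<lambda>y. map_pmf ((#) y) (map_pmf (map2 (+) (map f us)) (replicate_pmf (length us) ?N)))"
    for f :: "'v \<Rightarrow> int"
    by (simp add: map_pmf_def bind_assoc_pmf bind_return_pmf)
  show ?case
    unfolding unfold list.map(2)[of "\<lambda>u. \<alpha> * (of_int (f u - f' u))\<^sup>2 / (2 * s)"] sum_list.Cons
    by (intro renyi_bounded_bind renyi_bounded_map renyi_bounded_discrete_gaussian s \<alpha> Cons.IH)
qed

section \<open>Composition along the tree\<close>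

lemma renyi_bounded_inf_tda_node:
  assumes "s > 0" "\<alpha> > 1" "distinct (ch u)"
  shows "renyi_bounded \<alpha> (inf_tda_node ch q s (u, c)) (inf_tda_node ch q' s (u, c))
           (\<Sum>v\<in>set (ch u). \<alpha> * (of_int (q v - q' v))\<^sup>2 / (2 * s))"
proof -
  \<comment> \<open>With \<open>c\<close> fixed, \<open>g\<close> sees \<open>q\<close> only through
    the noisy vector, so it is one and the same post-processing for \<open>q\<close> and
    \<open>q'\<close>.\<close>
  define g where "g = (\<lambda>x. let y = int_opt x c in {(ch u ! j, y ! j) |j. j < length (ch u) \<and> y ! j > 0})"
  have "inf_tda_node ch q s (u, c) = map_pmf g
      (map_pmf (map2 (+) (map q (ch u))) (replicate_pmf (length (ch u)) (discrete_gaussian s)))" for q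
    by (simp add: inf_tda_node_def g_def map_pmf_def bind_assoc_pmf bind_return_pmf Let_def)
  thus ?thesis
    using renyi_bounded_map[OF assms(2) renyi_bounded_gaussian_noise[OF assms(1,2), of q "ch u" q'], of g]
      assms(3) by (simp add: sum_list_distinct_conv_sum_set)
qed

section \<open>Invariant of the released levels\<close>

lemma finite_level: "finite (level u0 ch l)"
  by (induction l) auto

text \<open>The graph of a finite partial function on \<open>U\<close>. Injectivity of
  \<open>fst\<close> keeps the children of a node from being charged twice.\<close>

definition level_labelling :: "'v set \<Rightarrow> ('v \<times> int) set \<Rightarrow> bool" where
  "level_labelling U V \<longleftrightarrow> finite V \<and> inj_on fst V \<and> fst ` V \<subseteq> U"

lemma rooted_treeD:
  assumes "rooted_tree u0 ch T" "l \<le> T" "u \<in> level u0 ch l"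
  shows "distinct (ch u)"
    and "v \<in> level u0 ch l \<Longrightarrow> u \<noteq> v \<Longrightarrow> set (ch u) \<inter> set (ch v) = {}"
  using assms unfolding rooted_tree_def Let_def by blast+

text \<open>A released node determines its parent, since distinct nodes of a level have disjoint
  children. The parent has a single value in \<open>V\<close>, and distinctness of its children list
  fixes the index, hence the released value.\<close>

lemma level_labelling_inf_tda_level:
  assumes tree: "rooted_tree u0 ch T" "l \<le> T"
    and V: "level_labelling (level u0 ch l) V"
    and V': "V' \<in> set_pmf (inf_tda_level ch q s V)"
  shows "level_labelling (level u0 ch (Suc l)) V'"
proof -
  have fin: "finite V" and inj: "inj_on fst V" and sub: "fst ` V \<subseteq> level u0 ch l"
    using V by (auto simp: level_labelling_def)
  obtain f where f: "f \<in> set_pmf (Pi_pmf V {} (inf_tda_node ch q s))" "V' = (\<Union>p\<in>V. f p)"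
    using V' by (auto simp: inf_tda_level_def)
  have fp: "\<exists>y. f p = (\<lambda>j. (ch (fst p) ! j, y ! j)) ` {j. j < length (ch (fst p)) \<and> y ! j > 0}"
    if "p \<in> V" for p :: "'a \<times> int"
  proof -
    have "f p \<in> set_pmf (inf_tda_node ch q s p)"
      using f(1) that fin by (cases p) (auto simp: set_Pi_pmf PiE_dflt_def)
    thus ?thesis
      by (cases p) (auto simp: inf_tda_node_def Let_def setcompr_eq_image)
  qed
  have "finite (f p)" if "p \<in> V" for p
    using fp[OF that] by auto
  hence "finite V'" using fin f(2) by auto
  moreover have "fst ` f p \<subseteq> set (ch (fst p))" if "p \<in> V" for p
    using fp[OF that] by auto
  note fst_f = this
  have "fst ` V' \<subseteq> level u0 ch (Suc l)"
    using fst_f sub unfolding f(2) by fastforce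
  moreover have "inj_on fst V'"
  proof (rule inj_onI)
    fix a b assume ab: "a \<in> V'" "b \<in> V'" "fst a = fst b"
    obtain p p' where p: "p \<in> V" "a \<in> f p" "p' \<in> V" "b \<in> f p'"
      using ab f(2) by auto
    have "fst a \<in> set (ch (fst p)) \<inter> set (ch (fst p'))"
      using fst_f[OF p(1)] fst_f[OF p(3)] p ab(3) by (metis IntI image_eqI subsetD)
    hence "fst p = fst p'"
      using rooted_treeD(2)[OF tree, of "fst p" "fst p'"] sub p by blast
    hence "p = p'" using inj p by (auto dest: inj_onD)
    moreover have "distinct (ch (fst p))"
      using rooted_treeD(1)[OF tree] sub p by blast
    ultimately show "a = b"
      using fp[OF p(1)] p ab(3) by (auto simp: nth_eq_iff_index_eq)
  qed
  ultimately show ?thesis by (simp add: level_labelling_def)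
qed

section \<open>Budget of a level and of the whole loop\<close>

lemma renyi_bounded_inf_tda_level:
  assumes s: "s > 0" and \<alpha>: "\<alpha> > 1"
    and tree: "rooted_tree u0 ch T" "l \<le> T"
    and V: "level_labelling (level u0 ch l) V"
    and le: "(\<Sum>u\<in>level u0 ch (Suc l). (of_int (q u - q' u))\<^sup>2) \<le> G"
  shows "renyi_bounded \<alpha> (inf_tda_level ch q s V) (inf_tda_level ch q' s V) (\<alpha> * G / (2 * s))"
proof -
  have fin: "finite V" and inj: "inj_on fst V" and sub: "fst ` V \<subseteq> level u0 ch l"
    using V by (auto simp: level_labelling_def)
  let ?d = "\<lambda>v. \<alpha> * (of_int (q v - q' v))\<^sup>2 / (2 * s)"
  have "renyi_bounded \<alpha> (Pi_pmf V {} (inf_tda_node ch q s)) (Pi_pmf V {} (inf_tda_node ch q' s))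
          (\<Sum>p\<in>V. \<Sum>v\<in>set (ch (fst p)). ?d v)"
  proof (rule renyi_bounded_Pi_pmf[OF \<alpha> fin])
    fix p assume "p \<in> V"
    hence "distinct (ch (fst p))" using rooted_treeD(1)[OF tree] sub by blast
    thus "renyi_bounded \<alpha> (inf_tda_node ch q s p) (inf_tda_node ch q' s p) (\<Sum>v\<in>set (ch (fst p)). ?d v)"
      using renyi_bounded_inf_tda_node[OF s \<alpha>, of ch "fst p" q "snd p" q'] by simp
  qed
  moreover have "(\<Sum>p\<in>V. \<Sum>v\<in>set (ch (fst p)). ?d v) \<le> \<alpha> * G / (2 * s)"
  proof -
    have "(\<Sum>p\<in>V. \<Sum>v\<in>set (ch (fst p)). ?d v) = (\<Sum>u\<in>fst ` V. \<Sum>v\<in>set (ch u). ?d v)"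
      using inj by (simp add: sum.reindex)
    also have "\<dots> = (\<Sum>v\<in>(\<Union>u\<in>fst ` V. set (ch u)). ?d v)"
      using fin rooted_treeD(2)[OF tree] sub
      by (intro sum.UNION_disjoint[symmetric]) (auto simp: subset_iff)
    \<comment> \<open>Nodes below discarded parents only add non-negative terms, so the bound is the
      same for every \<open>V\<close>.\<close>
    also have "\<dots> \<le> (\<Sum>v\<in>level u0 ch (Suc l). ?d v)"
      using s \<alpha> sub by (intro sum_mono2 finite_level) auto
    also have "\<dots> = \<alpha> * (\<Sum>v\<in>level u0 ch (Suc l). (of_int (q v - q' v))\<^sup>2) / (2 * s)"
      by (simp add: sum_distrib_left sum_divide_distrib)
    also have "\<dots> \<le> \<alpha> * G / (2 * s)"
      using s \<alpha> le by (intro divide_right_mono mult_left_mono) auto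
    finally show ?thesis .
  qed
  ultimately show ?thesis
    unfolding inf_tda_level_def using \<alpha> by (blast intro: renyi_bounded_map renyi_bounded_mono)
qed

text \<open>Composition asks for kernel bounds on reachable states only; this supplies the invariant
  there.\<close>

lemma level_labelling_inf_tda_loop:
  assumes "rooted_tree u0 ch T" "l \<le> T" "p \<in> set_pmf (inf_tda_loop u0 ch q s l)"
  shows "level_labelling (level u0 ch l) (fst p)"
  using assms(2,3)
proof (induction l arbitrary: p)
  case 0
  thus ?case by (simp add: level_labelling_def)
next
  case (Suc l)
  obtain V W where VW: "(V, W) \<in> set_pmf (inf_tda_loop u0 ch q s l)"
    "fst p \<in> set_pmf (inf_tda_level ch q s V)"
    using Suc.prems(2) by auto
  show ?case
    using level_labelling_inf_tda_level[OF assms(1) _ _ VW(2)] Suc.IH[OF _ VW(1)] Suc.prems(1) by simp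
qed

lemma renyi_bounded_inf_tda_loop:
  assumes s: "s > 0" and \<alpha>: "\<alpha> > 1" and tree: "rooted_tree u0 ch T"
    and root: "q u0 = q' u0"
    and le: "\<And>l. l \<in> {1..T} \<Longrightarrow> (\<Sum>u\<in>level u0 ch l. (of_int (q u - q' u))\<^sup>2) \<le> G"
    and "l \<le> T"
  shows "renyi_bounded \<alpha> (inf_tda_loop u0 ch q s l) (inf_tda_loop u0 ch q' s l) (l * (\<alpha> * G / (2 * s)))"
  using \<open>l \<le> T\<close>
proof (induction l)
  \<comment> \<open>The exact root value is the same in both runs, so the initial state costs
    nothing.\<close>
  case 0
  thus ?case using \<alpha> root by (simp add: renyi_bounded_refl)
next
  case (Suc l)
  \<comment> \<open>Both kernels start from the same state \<open>(V, W)\<close>; recording the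
    fresh level in \<open>W\<close> is post-processing.\<close>
  have step: "renyi_bounded \<alpha>
      (case p of (V, W) \<Rightarrow> map_pmf (\<lambda>V'. (V', W \<union> V')) (inf_tda_level ch q s V))
      (case p of (V, W) \<Rightarrow> map_pmf (\<lambda>V'. (V', W \<union> V')) (inf_tda_level ch q' s V))
      (\<alpha> * G / (2 * s))" if "p \<in> set_pmf (inf_tda_loop u0 ch q s l)" for p
  proof -
    have "l \<le> T" using Suc.prems by simp
    moreover have "level_labelling (level u0 ch l) (fst p)"
      using level_labelling_inf_tda_loop[OF tree _ that] Suc.prems by simp
    moreover have "(\<Sum>u\<in>level u0 ch (Suc l). (of_int (q u - q' u))\<^sup>2) \<le> G"
      using Suc.prems by (intro le) simp
    ultimately have "renyi_bounded \<alpha> (inf_tda_level ch q s (fst p)) (inf_tda_level ch q' s (fst p))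
        (\<alpha> * G / (2 * s))"
      by (rule renyi_bounded_inf_tda_level[OF s \<alpha> tree])
    thus ?thesis
      by (simp add: case_prod_unfold renyi_bounded_map[OF \<alpha>])
  qed
  have "renyi_bounded \<alpha> (inf_tda_loop u0 ch q s (Suc l)) (inf_tda_loop u0 ch q' s (Suc l))
      (l * (\<alpha> * G / (2 * s)) + \<alpha> * G / (2 * s))"
    using renyi_bounded_bind[OF \<alpha> Suc.IH step] Suc.prems by (simp add: map_pmf_def)
  moreover have "l * (\<alpha> * G / (2 * s)) + \<alpha> * G / (2 * s) = Suc l * (\<alpha> * G / (2 * s))"
    by (simp add: distrib_right del: times_divide_eq_right)
  ultimately show ?case by (simp only:)
qed

theorem theorem4p2:
  fixes u0 :: 'v and ch :: "'v \<Rightarrow> 'v list"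
    and q :: "'r list \<Rightarrow> 'v \<Rightarrow> int"
    and T n :: nat and \<rho> GS2 :: real
  assumes "\<rho> > 0"
    and "\<And>D. D \<in> datasets n \<Longrightarrow> nonneg_hierarchical_tree u0 ch T (q D)"
    and "\<And>D. D \<in> datasets n \<Longrightarrow> q D u0 = int n"
    and "\<And>l D D'. \<lbrakk>l \<in> {1..T}; D \<in> datasets n; D' \<in> datasets n; bounded_neighbors D D'\<rbrakk> \<Longrightarrow>
           L2_set (\<lambda>u. real_of_int (q D u) - real_of_int (q D' u)) (level u0 ch l) \<le> GS2"
  shows "zCDP (datasets n) bounded_neighbors (GS2\<^sup>2 * (\<rho> / 2))
           (\<lambda>D. inf_tda u0 ch T (q D) \<rho>)"
  unfolding zCDP_def
proof (intro ballI allI impI)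
  fix D D' :: "'r list" and \<alpha> :: real
  assume D: "D \<in> datasets n" "D' \<in> datasets n" "bounded_neighbors D D'" and \<alpha>: "\<alpha> > 1"
  \<comment> \<open>Substituting a record preserves the size \<open>n\<close>, which is the root
    attribute.\<close>
  have root: "q D u0 = q D' u0" using assms(3) D by simp
  have "renyi_bounded \<alpha> (inf_tda u0 ch T (q D) \<rho>) (inf_tda u0 ch T (q D') \<rho>) (\<alpha> * (GS2\<^sup>2 * (\<rho> / 2)))"
  \<comment> \<open>At depth zero the noise parameter would be 0, where
    \<open>discrete_gaussian\<close> is unspecified; no noise is drawn and only the root is
    released.\<close>
  proof (cases "T = 0")
    case True
    thus ?thesis
      using assms(1) \<alpha> root by (simp add: inf_tda_def renyi_bounded_refl)
  next
    case False
    have tree: "rooted_tree u0 ch T"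
      using assms(2)[OF D(1)] by (simp add: nonneg_hierarchical_tree_def)
    have sens: "(\<Sum>u\<in>level u0 ch l. (of_int (q D u - q D' u))\<^sup>2) \<le> GS2\<^sup>2" if "l \<in> {1..T}" for l
      using assms(4)[OF that D] by (simp add: L2_set_def sum_nonneg real_sqrt_le_iff sqrt_le_D)
    have s: "real T / \<rho> > 0" using False assms(1) by simp
    \<comment> \<open>The variance parameter grows with \<open>T\<close>, which cancels the number
      of composed levels.\<close>
    have "real T * (\<alpha> * GS2\<^sup>2 / (2 * (real T / \<rho>))) = \<alpha> * (GS2\<^sup>2 * (\<rho> / 2))"
      using False assms(1) by (simp add: field_simps)
    thus ?thesis
      unfolding inf_tda_def
      using renyi_bounded_map[OF \<alpha> renyi_bounded_inf_tda_loop[OF s \<alpha> tree root sens order.refl], of snd]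
      by (simp only:)
  qed
  thus "renyi_divergence \<alpha> (inf_tda u0 ch T (q D) \<rho>) (inf_tda u0 ch T (q D') \<rho>)
          \<le> ereal (\<alpha> * (GS2\<^sup>2 * (\<rho> / 2)))"
    using \<alpha> by (rule renyi_boundedD)
qed

end
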